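(* Let $d\ge 1$, $R>0$ and $\sigma_1,\sigma_2>0$. Define $t_1:\mathbb{R}^d\to\mathbb{R}^d$ by $t_1(\boldsymbol x)=\boldsymbol x$ and $t_2:\mathbb{R}^d\to\mathbb{R}^{d_2}$ by $$t_2(\boldsymbol x)=\big(x_1^2,\ldots,x_d^2,\ \sqrt2\,x_1x_2,\ \ldots,\ \sqrt2\,x_{d-1}x_d\big)^T,$$ i.e. the vector whose entries are $x_i^2$ for $1\le i\le d$ and $\sqrt2\,x_ix_j$ for $1\le i<j\le d$, with $d_2 = d(d+1)/2$ its number of entries. For a record $(\boldsymbol x,y)$ with $\boldsymbol x\in\mathbb{R}^d$, $\|\boldsymbol x\|_2\le R$ and $y\in\{-1,1\}$, consider the mechanism $$\mathcal M(\boldsymbol x,y)=\begin{bmatrix} y\,t_1(\boldsymbol x)\\ t_2(\boldsymbol x)\end{bmatrix}+\mathcal N\!\left(0,\begin{bmatrix}\sigma_1^2 I_d & 0\\ 0 & \sigma_2^2 I_{d_2}\end{bmatrix}\right).$$ Then the tight $(\epsilon,\delta)$-DP guarantee for $\mathcal M$ (with respect to replacing a record $(\boldsymbol x,y)$ by another record $(\boldsymbol x',y')$ satisfying the same constraints) is obtained by considering a Gaussian mechanism with noise variance $\sigma_1^2$ and $L_2$-sensitivity $$\Delta=\sqrt{\frac{\sigma_2^2}{2\sigma_1^2}+2R^2+2\frac{\sigma_1^2}{\sigma_2^2}R^4};$$ that is, for $\epsilon\ge 0$, $\delta\in[0,1]$, $\mathcal M$ is $(\epsilon,\delta)$-DP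 whenever $\Phi\!\left(\frac{\Delta}{2\sigma_1}-\frac{\epsilon\sigma_1}{\Delta}\right)-e^{\epsilon}\Phi\!\left(-\frac{\Delta}{2\sigma_1}-\frac{\epsilon\sigma_1}{\Delta}\right)\le\delta$.
   Context: A randomized mechanism $\mathcal M$ is $(\epsilon,\delta)$-differentially private if for all neighbouring inputs $D\sim D'$ (here: inputs differing by replacement of one record) and all measurable output sets $O$, $\Pr[\mathcal M(D)\in O]\le e^{\epsilon}\Pr[\mathcal M(D')\in O]+\delta$. The $L_2$-sensitivity of a function $t$ is $\max_{D\sim D'}\|t(D)-t(D')\|_2$. The Gaussian mechanism $t(D)+\mathcal N(0,\sigma^2 I)$ with $L_2$-sensitivity $\Delta$ is $(\epsilon,\delta)$-DP iff $\Phi(\frac{\Delta}{2\sigma}-\frac{\epsilon\sigma}{\Delta})-e^{\epsilon}\Phi(-\frac{\Delta}{2\sigma}-\frac{\epsilon\sigma}{\Delta})\le\delta$, where $\Phi$ is the standard normal CDF. This lemma arises in logistic regression, where labels satisfy $y\in\{-1,1\}$. *)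

theory Defs
  imports "HOL-Probability.Probability"
begin

definition Phi :: "real \<Rightarrow> real" where
  "Phi t = measure (density lborel std_normal_density) {..t}"

definition is_dp :: "('a \<Rightarrow> 'b measure) \<Rightarrow> ('a \<Rightarrow> 'a \<Rightarrow> bool) \<Rightarrow> real \<Rightarrow> real \<Rightarrow> bool" where
  "is_dp M nb \<epsilon> \<delta> \<longleftrightarrow>
     (\<forall>D D'. nb D D' \<longrightarrow>
        (\<forall>S \<in> sets (M D). measure (M D) S \<le> exp \<epsilon> * measure (M D') S + \<delta>))"

text \<open>Output coordinates: Inl i (i < d) for y * x_i; Inr (i,j) (i \<le> j < d) for
  the entries of t_2(x): x_i^2 if i = j and sqrt 2 * x_i * x_j if i < j.\<close>
definition out_idx :: "nat \<Rightarrow> (nat + nat \<times> nat) set" where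
  "out_idx d = Inl ` {..<d} \<union> Inr ` {(i, j). i \<le> j \<and> j < d}"

definition t2 :: "(nat \<Rightarrow> real) \<Rightarrow> nat \<times> nat \<Rightarrow> real" where
  "t2 x = (\<lambda>(i, j). if i = j then (x i)\<^sup>2 else sqrt 2 * x i * x j)"

definition mech_mean :: "(nat \<Rightarrow> real) \<times> real \<Rightarrow> nat + nat \<times> nat \<Rightarrow> real" where
  "mech_mean r k = (case k of Inl i \<Rightarrow> snd r * fst r i | Inr p \<Rightarrow> t2 (fst r) p)"

definition mech :: "nat \<Rightarrow> real \<Rightarrow> real \<Rightarrow> (nat \<Rightarrow> real) \<times> real \<Rightarrow> (nat + nat \<times> nat \<Rightarrow> real) measure" where
  "mech d \<sigma>1 \<sigma>2 r = PiM (out_idx d) (\<lambda>k. density lborel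
      (normal_density (mech_mean r k) (case k of Inl _ \<Rightarrow> \<sigma>1 | Inr _ \<Rightarrow> \<sigma>2)))"

definition valid_record :: "nat \<Rightarrow> real \<Rightarrow> (nat \<Rightarrow> real) \<times> real \<Rightarrow> bool" where
  "valid_record d R r \<longleftrightarrow> sqrt (\<Sum>i<d. (fst r i)\<^sup>2) \<le> R \<and> snd r \<in> {-1, 1}"

end

theory Submission
  imports Defs
begin

text \<open>
  With every output coordinate divided by its noise level, the mechanism becomes a spherical
  Gaussian mechanism. For two spherical Gaussians whose means are at distance \<open>D\<close>, the density
  ratio is the exponential of an affine function (the privacy loss), so the set where the loss
  exceeds \<open>\<epsilon>\<close> maximises \<open>P S - e\<^sup>\<epsilon> Q S\<close>; it is a halfspace, and its two measures give
  \<open>\<Phi>(D/2 - \<epsilon>/D) - e\<^sup>\<epsilon> \<Phi>(-D/2 - \<epsilon>/D)\<close>, which is increasing in \<open>D\<close>.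
  Since \<open>\<langle>t\<^sub>2 x, t\<^sub>2 x'\<rangle> = \<langle>x, x'\<rangle>\<^sup>2\<close>, the scaled squared distance of the two means is
  \<open>(|x|\<^sup>2 + |x'|\<^sup>2 - 2yy'u)/\<sigma>\<^sub>1\<^sup>2 + (|x|\<^sup>4 + |x'|\<^sup>4 - 2u\<^sup>2)/\<sigma>\<^sub>2\<^sup>2\<close> with \<open>u = \<langle>x, x'\<rangle>\<close>, and completing
  the square in \<open>u\<close> bounds it by \<open>(\<Delta>/\<sigma>\<^sub>1)\<^sup>2\<close>.
\<close>

lemma indicator_PiE_eq_prod:
  assumes "finite I" and "x \<in> extensional I"
  shows "(indicator (Pi\<^sub>E I A) x :: ennreal) = (\<Prod>i\<in>I. indicator (A i) (x i))"
proof (cases "x \<in> Pi\<^sub>E I A")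
  case True
  then show ?thesis by (simp add: PiE_iff indicator_def)
next
  case False
  with assms obtain i where "i \<in> I" "x i \<notin> A i" by (auto simp: PiE_iff)
  with False \<open>finite I\<close> show ?thesis by (subst prod_zero) (auto simp: indicator_def)
qed

lemma PiM_density_lborel:
  fixes f :: "'i \<Rightarrow> real \<Rightarrow> real"
  assumes I: "finite I" and f: "\<And>i. f i \<in> borel_measurable borel"
  shows "PiM I (\<lambda>i. density lborel (\<lambda>y. ennreal (f i y)))
       = density (PiM I (\<lambda>_. lborel)) (\<lambda>x. \<Prod>i\<in>I. ennreal (f i (x i)))"
proof -
  let ?N = "\<lambda>i. density lborel (\<lambda>y. ennreal (f i y))"
  interpret N: product_sigma_finite ?N
    unfolding product_sigma_finite_def
    using f
    by (subst sigma_finite_measure.sigma_finite_iff_density_finite'[OF lborel.sigma_finite_measure_axioms])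
      auto
  interpret L: product_sigma_finite "\<lambda>_. lborel :: real measure"
    by (simp add: product_sigma_finite_def lborel.sigma_finite_measure_axioms)
  have "density (PiM I (\<lambda>_. lborel)) (\<lambda>x. \<Prod>i\<in>I. ennreal (f i (x i))) = PiM I ?N"
  proof (rule N.PiM_eqI[OF I])
    fix A assume "\<And>i. i \<in> I \<Longrightarrow> A i \<in> sets (?N i)"
    then have A: "\<And>i. i \<in> I \<Longrightarrow> A i \<in> sets borel" by simp
    have "emeasure (density (PiM I (\<lambda>_. lborel)) (\<lambda>x. \<Prod>i\<in>I. ennreal (f i (x i)))) (Pi\<^sub>E I A)
        = (\<integral>\<^sup>+ x. (\<Prod>i\<in>I. ennreal (f i (x i))) * indicator (Pi\<^sub>E I A) x \<partial>PiM I (\<lambda>_. lborel))"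
      using A f by (subst emeasure_density) (auto intro!: sets_PiM_I_finite I)
    also have "\<dots> = (\<integral>\<^sup>+ x. (\<Prod>i\<in>I. ennreal (f i (x i)) * indicator (A i) (x i)) \<partial>PiM I (\<lambda>_. lborel))"
      by (intro nn_integral_cong) (simp add: space_PiM indicator_PiE_eq_prod I prod.distrib PiE_iff)
    also have "\<dots> = (\<Prod>i\<in>I. \<integral>\<^sup>+ y. ennreal (f i y) * indicator (A i) y \<partial>lborel)"
      using A f by (intro L.product_nn_integral_prod I) auto
    also have "\<dots> = (\<Prod>i\<in>I. emeasure (?N i) (A i))"
      using A f by (intro prod.cong refl) (simp add: emeasure_density)
    finally show "emeasure (density (PiM I (\<lambda>_. lborel)) (\<lambda>x. \<Prod>i\<in>I. ennreal (f i (x i)))) (Pi\<^sub>E I A)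
        = (\<Prod>i\<in>I. emeasure (?N i) (A i))" .
  qed (auto intro!: sets_PiM_cong)
  then show ?thesis ..
qed

lemma indep_vars_PiM_components:
  assumes "I \<noteq> {}" and M: "\<And>i. i \<in> I \<Longrightarrow> prob_space (M i)"
  shows "prob_space.indep_vars (PiM I M) M (\<lambda>i x. x i) I"
proof -
  interpret prob_space "PiM I M" using M by (rule prob_space_PiM)
  have "distr (PiM I M) (PiM I M) (\<lambda>x. \<lambda>i\<in>I. x i) = distr (PiM I M) (PiM I M) (\<lambda>x. x)"
    by (intro distr_cong) (auto simp: space_PiM PiE_def extensional_def restrict_def)
  also have "\<dots> = PiM I (\<lambda>i. distr (PiM I M) (M i) (\<lambda>x. x i))"
    using M by (auto intro!: PiM_cong simp: distr_PiM_component)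
  finally show ?thesis
    using assms(1) by (subst indep_vars_iff_distr_eq_PiM') (auto simp: measurable_component_singleton)
qed

lemma (in prob_space) prob_std_normal_less:
  assumes V: "distributed M lborel V std_normal_density"
  shows "prob {x \<in> space M. V x < t} = Phi t"
proof -
  have "emeasure M {x \<in> space M. V x < t} = emeasure M (V -` {..<t} \<inter> space M)"
    by (intro arg_cong[where f="emeasure M"]) auto
  also have "\<dots> = (\<integral>\<^sup>+x. ennreal (std_normal_density x) * indicator {..<t} x \<partial>lborel)"
    by (rule distributed_emeasure[OF V]) simp
  also have "\<dots> = (\<integral>\<^sup>+x. ennreal (std_normal_density x) * indicator {..t} x \<partial>lborel)"
    by (intro nn_integral_cong_AE)
      (use AE_lborel_singleton[of t] in \<open>auto elim!: eventually_mono simp: indicator_def\<close>)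
  also have "\<dots> = emeasure (density lborel std_normal_density) {..t}"
    by (subst emeasure_density) auto
  finally show ?thesis
    by (simp add: Phi_def measure_def)
qed

lemma (in prob_space) prob_normal_greater:
  assumes \<sigma>: "0 < \<sigma>" and Z: "distributed M lborel Z (normal_density m \<sigma>)"
  shows "prob {x \<in> space M. b < Z x} = Phi ((m - b) / \<sigma>)"
proof -
  have "distributed M lborel (\<lambda>x. m / \<sigma> + (- 1 / \<sigma>) * Z x)
      (normal_density (m / \<sigma> + (- 1 / \<sigma>) * m) (\<bar>- 1 / \<sigma>\<bar> * \<sigma>))"
    using \<sigma> by (intro normal_density_affine[OF Z]) auto
  then have "distributed M lborel (\<lambda>x. m / \<sigma> - Z x / \<sigma>) std_normal_density"
    using \<sigma> by simp
  moreover have "{x \<in> space M. b < Z x} = {x \<in> space M. m / \<sigma> - Z x / \<sigma> < (m - b) / \<sigma>}"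
    using \<sigma> by (auto simp: field_simps)
  ultimately show ?thesis
    by (simp add: prob_std_normal_less)
qed

lemma normal_density_mean_shift:
  assumes "0 < \<sigma>"
  shows "normal_density \<mu> \<sigma> y = normal_density \<nu> \<sigma> y * exp ((\<mu> - \<nu>) / \<sigma>\<^sup>2 * (y - (\<mu> + \<nu>) / 2))"
proof -
  have "-(y - \<mu>)\<^sup>2 / (2 * \<sigma>\<^sup>2) = -(y - \<nu>)\<^sup>2 / (2 * \<sigma>\<^sup>2) + (\<mu> - \<nu>) / \<sigma>\<^sup>2 * (y - (\<mu> + \<nu>) / 2)"
    using assms by (simp add: field_simps power2_eq_square)
  then have "exp (-(y - \<mu>)\<^sup>2 / (2 * \<sigma>\<^sup>2))
      = exp (-(y - \<nu>)\<^sup>2 / (2 * \<sigma>\<^sup>2)) * exp ((\<mu> - \<nu>) / \<sigma>\<^sup>2 * (y - (\<mu> + \<nu>) / 2))"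
    by (simp add: exp_add[symmetric])
  then show ?thesis
    by (simp add: normal_density_def mult.assoc)
qed

definition normal_PiM :: "'i set \<Rightarrow> ('i \<Rightarrow> real) \<Rightarrow> ('i \<Rightarrow> real) \<Rightarrow> ('i \<Rightarrow> real) measure" where
  "normal_PiM I \<mu> \<sigma> = PiM I (\<lambda>i. density lborel (normal_density (\<mu> i) (\<sigma> i)))"

lemma prob_space_normal_PiM: "(\<And>i. i \<in> I \<Longrightarrow> 0 < \<sigma> i) \<Longrightarrow> prob_space (normal_PiM I \<mu> \<sigma>)"
  unfolding normal_PiM_def by (intro prob_space_PiM prob_space_normal_density) auto

lemma sets_normal_PiM [measurable_cong]: "sets (normal_PiM I \<mu> \<sigma>) = sets (PiM I (\<lambda>_. borel))"
  unfolding normal_PiM_def by (rule sets_PiM_cong) simp_all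

lemma space_normal_PiM: "space (normal_PiM I \<mu> \<sigma>) = space (PiM I (\<lambda>_. borel))"
  by (rule sets_eq_imp_space_eq[OF sets_normal_PiM])

lemma normal_PiM_eq_density:
  assumes "finite I"
  shows "normal_PiM I \<mu> \<sigma>
       = density (PiM I (\<lambda>_. lborel)) (\<lambda>x. ennreal (\<Prod>i\<in>I. normal_density (\<mu> i) (\<sigma> i) (x i)))"
  unfolding normal_PiM_def
  by (subst PiM_density_lborel[OF assms]) (simp_all add: prod_ennreal)

lemma normal_PiM_eqI:
  "(\<And>i. i \<in> I \<Longrightarrow> \<mu> i = \<nu> i) \<Longrightarrow> normal_PiM I \<mu> \<sigma> = normal_PiM I \<nu> \<sigma>"
  unfolding normal_PiM_def by (intro PiM_cong) auto

lemma distributed_normal_PiM_component: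
  assumes i: "i \<in> I" and \<sigma>: "\<And>i. i \<in> I \<Longrightarrow> 0 < \<sigma> i"
  shows "distributed (normal_PiM I \<mu> \<sigma>) lborel (\<lambda>x. x i) (normal_density (\<mu> i) (\<sigma> i))"
proof -
  have "distr (normal_PiM I \<mu> \<sigma>) lborel (\<lambda>x. x i)
      = distr (normal_PiM I \<mu> \<sigma>) (density lborel (normal_density (\<mu> i) (\<sigma> i))) (\<lambda>x. x i)"
    by (intro distr_cong) auto
  also have "\<dots> = density lborel (normal_density (\<mu> i) (\<sigma> i))"
    unfolding normal_PiM_def using assms by (intro distr_PiM_component prob_space_normal_density) auto
  finally show ?thesis
    using i by (auto simp: distributed_def normal_PiM_def measurable_component_singleton)
qed

lemma distributed_normal_PiM_linear:
  assumes I: "finite I" and \<sigma>: "\<And>i. i \<in> I \<Longrightarrow> 0 < \<sigma> i"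
    and J: "J \<subseteq> I" "J \<noteq> {}" and a: "\<And>i. i \<in> J \<Longrightarrow> a i \<noteq> 0"
  shows "distributed (normal_PiM I \<mu> \<sigma>) lborel (\<lambda>x. \<Sum>i\<in>J. a i * x i)
           (normal_density (\<Sum>i\<in>J. a i * \<mu> i) (sqrt (\<Sum>i\<in>J. (a i * \<sigma> i)\<^sup>2)))"
proof -
  interpret prob_space "normal_PiM I \<mu> \<sigma>" using \<sigma> by (rule prob_space_normal_PiM)
  have "indep_vars (\<lambda>i. density lborel (normal_density (\<mu> i) (\<sigma> i))) (\<lambda>i x. x i) I"
    using J \<sigma> unfolding normal_PiM_def
    by (intro indep_vars_PiM_components prob_space_normal_density) auto
  then have "indep_vars (\<lambda>_. borel) (\<lambda>i x. a i * x i) J"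
    by (intro indep_vars_subset[OF _ J(1)]) (rule indep_vars_compose2, auto)
  moreover have "distributed (normal_PiM I \<mu> \<sigma>) lborel (\<lambda>x. a i * x i)
      (normal_density (a i * \<mu> i) (\<bar>a i\<bar> * \<sigma> i))" if "i \<in> J" for i
  proof -
    have "i \<in> I" "0 < \<sigma> i" "a i \<noteq> 0"
      using that J \<sigma> a by auto
    from normal_density_affine[OF distributed_normal_PiM_component[OF this(1) \<sigma>] this(2,3), of 0]
    show ?thesis by simp
  qed
  ultimately have "distributed (normal_PiM I \<mu> \<sigma>) lborel (\<lambda>x. \<Sum>i\<in>J. a i * x i)
      (normal_density (\<Sum>i\<in>J. a i * \<mu> i) (sqrt (\<Sum>i\<in>J. (\<bar>a i\<bar> * \<sigma> i)\<^sup>2)))"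
    using J \<sigma> a finite_subset[OF J(1) I] by (intro sum_indep_normal) auto
  then show ?thesis
    by (simp add: power_mult_distrib)
qed

lemma measure_normal_PiM_halfspace:
  assumes I: "finite I" and \<sigma>: "\<And>i. i \<in> I \<Longrightarrow> 0 < \<sigma> i"
    and pos: "0 < (\<Sum>i\<in>I. (a i * \<sigma> i)\<^sup>2)"
  shows "measure (normal_PiM I \<mu> \<sigma>) {x \<in> space (normal_PiM I \<mu> \<sigma>). b < (\<Sum>i\<in>I. a i * x i)}
       = Phi (((\<Sum>i\<in>I. a i * \<mu> i) - b) / sqrt (\<Sum>i\<in>I. (a i * \<sigma> i)\<^sup>2))"
proof -
  interpret prob_space "normal_PiM I \<mu> \<sigma>" using \<sigma> by (rule prob_space_normal_PiM)
  \<comment> \<open>Zero coefficients are dropped: \<open>sum_indep_normal\<close> needs every summand to have positive variance.\<close>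
  define J where "J = {i \<in> I. a i \<noteq> 0}"
  have sum_J: "(\<Sum>i\<in>I. f i) = (\<Sum>i\<in>J. f i)" if "\<And>i. a i = 0 \<Longrightarrow> f i = 0" for f :: "_ \<Rightarrow> real"
    using that by (intro sum.mono_neutral_right I) (auto simp: J_def)
  have "J \<noteq> {}"
    using pos sum_J[of "\<lambda>i. (a i * \<sigma> i)\<^sup>2"] by auto
  then have "distributed (normal_PiM I \<mu> \<sigma>) lborel (\<lambda>x. \<Sum>i\<in>J. a i * x i)
      (normal_density (\<Sum>i\<in>J. a i * \<mu> i) (sqrt (\<Sum>i\<in>J. (a i * \<sigma> i)\<^sup>2)))"
    by (intro distributed_normal_PiM_linear I \<sigma>) (auto simp: J_def)
  with pos show ?thesis
    by (simp add: sum_J[of "\<lambda>i. a i * _ i"] sum_J[of "\<lambda>i. (a i * \<sigma> i)\<^sup>2"] prob_normal_greater)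
qed

lemma measure_density_scaled_le:
  fixes p q :: "'a \<Rightarrow> real"
  assumes fin: "finite_measure (density L p)" "finite_measure (density L q)"
    and meas: "p \<in> borel_measurable L" "q \<in> borel_measurable L"
    and nonneg: "\<And>x. 0 \<le> p x" "\<And>x. 0 \<le> q x"
    and B: "B \<in> sets L" and c: "0 \<le> c1" "0 \<le> c2"
    and le: "\<And>x. x \<in> B \<Longrightarrow> c1 * p x \<le> c2 * q x"
  shows "c1 * measure (density L p) B \<le> c2 * measure (density L q) B"
proof -
  interpret P: finite_measure "density L p" by (rule fin)
  interpret Q: finite_measure "density L q" by (rule fin)
  have "ennreal c1 * emeasure (density L p) B = (\<integral>\<^sup>+x. ennreal c1 * (ennreal (p x) * indicator B x) \<partial>L)"
    using B meas by (simp add: emeasure_density nn_integral_cmult)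
  also have "\<dots> \<le> (\<integral>\<^sup>+x. ennreal c2 * (ennreal (q x) * indicator B x) \<partial>L)"
    using le c nonneg
    by (intro nn_integral_mono) (auto simp: indicator_def ennreal_mult[symmetric] ennreal_leI)
  also have "\<dots> = ennreal c2 * emeasure (density L q) B"
    using B meas by (simp add: emeasure_density nn_integral_cmult)
  finally show ?thesis
    using c by (simp add: P.emeasure_eq_measure Q.emeasure_eq_measure ennreal_mult[symmetric])
qed

lemma hockey_stick_le_loss_set:
  fixes L :: "'a measure" and p q loss :: "'a \<Rightarrow> real" and \<epsilon> :: real
  defines "P \<equiv> density L p" and "Q \<equiv> density L q" and "A \<equiv> {x \<in> space L. \<epsilon> < loss x}"
  assumes fin: "finite_measure P" "finite_measure Q"
    and meas: "p \<in> borel_measurable L" "q \<in> borel_measurable L" "loss \<in> borel_measurable L"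
    and q_nonneg: "\<And>x. 0 \<le> q x" and ratio: "\<And>x. p x = q x * exp (loss x)"
    and S: "S \<in> sets L"
  shows "measure P S - exp \<epsilon> * measure Q S \<le> measure P A - exp \<epsilon> * measure Q A"
proof -
  interpret P: finite_measure P by (rule fin)
  interpret Q: finite_measure Q by (rule fin)
  have p_nonneg: "0 \<le> p x" for x
    using q_nonneg[of x] by (simp add: ratio)
  have A: "A \<in> sets L"
    unfolding A_def using meas(3) by measurable
  have sets: "sets P = sets L" "sets Q = sets L"
    by (simp_all add: P_def Q_def)
  have "exp \<epsilon> * measure Q (A - S) \<le> 1 * measure P (A - S)"
    unfolding P_def Q_def
  proof (rule measure_density_scaled_le[OF fin(2)[unfolded Q_def] fin(1)[unfolded P_def] meas(2,1)
        q_nonneg p_nonneg])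
    fix x assume "x \<in> A - S"
    then have exp_le: "exp \<epsilon> \<le> exp (loss x)" by (simp add: A_def)
    show "exp \<epsilon> * q x \<le> 1 * p x"
      using mult_right_mono[OF exp_le q_nonneg[of x]] by (simp add: ratio mult.commute)
  qed (use A S in auto)
  moreover have "1 * measure P (S - A) \<le> exp \<epsilon> * measure Q (S - A)"
    unfolding P_def Q_def
  proof (rule measure_density_scaled_le[OF fin[unfolded P_def Q_def] meas(1,2) p_nonneg q_nonneg])
    fix x assume "x \<in> S - A"
    with sets.sets_into_space[OF S] have exp_le: "exp (loss x) \<le> exp \<epsilon>" by (auto simp: A_def)
    show "1 * p x \<le> exp \<epsilon> * q x"
      using mult_right_mono[OF exp_le q_nonneg[of x]] by (simp add: ratio mult.commute)
  qed (use A S in auto)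
  ultimately show ?thesis
    using A S sets P.finite_measure_Diff'[of A S] P.finite_measure_Diff'[of S A]
      Q.finite_measure_Diff'[of A S] Q.finite_measure_Diff'[of S A]
    by (simp add: Int_commute algebra_simps)
qed

definition normal_privacy_loss ::
  "'i set \<Rightarrow> ('i \<Rightarrow> real) \<Rightarrow> ('i \<Rightarrow> real) \<Rightarrow> ('i \<Rightarrow> real) \<Rightarrow> ('i \<Rightarrow> real) \<Rightarrow> real" where
  "normal_privacy_loss I \<mu> \<nu> \<sigma> x = (\<Sum>i\<in>I. (\<mu> i - \<nu> i) / (\<sigma> i)\<^sup>2 * (x i - (\<mu> i + \<nu> i) / 2))"

lemma borel_measurable_normal_privacy_loss [measurable]:
  "normal_privacy_loss I \<mu> \<nu> \<sigma> \<in> borel_measurable (PiM I (\<lambda>_. borel))"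
  unfolding normal_privacy_loss_def by measurable

lemma prod_normal_density_eq_exp_loss:
  assumes I: "finite I" and \<sigma>: "\<And>i. i \<in> I \<Longrightarrow> 0 < \<sigma> i"
  shows "(\<Prod>i\<in>I. normal_density (\<mu> i) (\<sigma> i) (x i))
       = (\<Prod>i\<in>I. normal_density (\<nu> i) (\<sigma> i) (x i)) * exp (normal_privacy_loss I \<mu> \<nu> \<sigma> x)"
proof -
  have "(\<Prod>i\<in>I. normal_density (\<mu> i) (\<sigma> i) (x i))
      = (\<Prod>i\<in>I. normal_density (\<nu> i) (\<sigma> i) (x i)
           * exp ((\<mu> i - \<nu> i) / (\<sigma> i)\<^sup>2 * (x i - (\<mu> i + \<nu> i) / 2)))"
    by (intro prod.cong refl normal_density_mean_shift \<sigma>)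
  then show ?thesis
    by (simp add: prod.distrib exp_sum I normal_privacy_loss_def)
qed

lemma normal_privacy_loss_at_means:
  "normal_privacy_loss I \<mu> \<nu> \<sigma> \<mu> = (\<Sum>i\<in>I. ((\<mu> i - \<nu> i) / \<sigma> i)\<^sup>2) / 2"
  "normal_privacy_loss I \<mu> \<nu> \<sigma> \<nu> = - (\<Sum>i\<in>I. ((\<mu> i - \<nu> i) / \<sigma> i)\<^sup>2) / 2"
proof -
  have "(\<mu> i - \<nu> i) / (\<sigma> i)\<^sup>2 * (\<mu> i - (\<mu> i + \<nu> i) / 2) = ((\<mu> i - \<nu> i) / \<sigma> i)\<^sup>2 / 2"
    and "(\<mu> i - \<nu> i) / (\<sigma> i)\<^sup>2 * (\<nu> i - (\<mu> i + \<nu> i) / 2) = - ((\<mu> i - \<nu> i) / \<sigma> i)\<^sup>2 / 2" for i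
    by (cases "\<sigma> i = 0"; simp add: power2_eq_square field_simps)+
  note terms = this
  show "normal_privacy_loss I \<mu> \<nu> \<sigma> \<mu> = (\<Sum>i\<in>I. ((\<mu> i - \<nu> i) / \<sigma> i)\<^sup>2) / 2"
    and "normal_privacy_loss I \<mu> \<nu> \<sigma> \<nu> = - (\<Sum>i\<in>I. ((\<mu> i - \<nu> i) / \<sigma> i)\<^sup>2) / 2"
    by (simp_all only: normal_privacy_loss_def terms sum_divide_distrib sum_negf[symmetric])
qed

lemma measure_normal_PiM_loss_greater:
  assumes I: "finite I" and \<sigma>: "\<And>i. i \<in> I \<Longrightarrow> 0 < \<sigma> i"
    and D: "D = sqrt (\<Sum>i\<in>I. ((\<mu> i - \<nu> i) / \<sigma> i)\<^sup>2)" "0 < D"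
  shows "measure (normal_PiM I m \<sigma>) {x \<in> space (normal_PiM I m \<sigma>). \<epsilon> < normal_privacy_loss I \<mu> \<nu> \<sigma> x}
       = Phi ((normal_privacy_loss I \<mu> \<nu> \<sigma> m - \<epsilon>) / D)"
proof -
  define a where "a i = (\<mu> i - \<nu> i) / (\<sigma> i)\<^sup>2" for i
  define c where "c = (\<Sum>i\<in>I. a i * ((\<mu> i + \<nu> i) / 2))"
  have loss: "normal_privacy_loss I \<mu> \<nu> \<sigma> x = (\<Sum>i\<in>I. a i * x i) - c" for x
    by (simp add: normal_privacy_loss_def a_def c_def right_diff_distrib sum_subtractf)
  have "a i * \<sigma> i = (\<mu> i - \<nu> i) / \<sigma> i" if "i \<in> I" for i
    using \<sigma>[OF that] by (simp add: a_def power2_eq_square)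
  then have "(\<Sum>i\<in>I. (a i * \<sigma> i)\<^sup>2) = (\<Sum>i\<in>I. ((\<mu> i - \<nu> i) / \<sigma> i)\<^sup>2)"
    by simp
  then have var: "(\<Sum>i\<in>I. (a i * \<sigma> i)\<^sup>2) = D\<^sup>2"
    using D by (simp add: sum_nonneg)
  have "0 < (\<Sum>i\<in>I. (a i * \<sigma> i)\<^sup>2)"
    unfolding var using D(2) by simp
  then have "measure (normal_PiM I m \<sigma>) {x \<in> space (normal_PiM I m \<sigma>). \<epsilon> + c < (\<Sum>i\<in>I. a i * x i)}
      = Phi (((\<Sum>i\<in>I. a i * m i) - (\<epsilon> + c)) / sqrt (\<Sum>i\<in>I. (a i * \<sigma> i)\<^sup>2))"
    using measure_normal_PiM_halfspace[OF I \<sigma>, where a=a and \<mu>=m and b="\<epsilon> + c"] by simp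
  then show ?thesis
    using D var by (simp add: loss algebra_simps)
qed

definition gaussian_delta :: "real \<Rightarrow> real \<Rightarrow> real" where
  "gaussian_delta \<epsilon> D = Phi (D / 2 - \<epsilon> / D) - exp \<epsilon> * Phi (- D / 2 - \<epsilon> / D)"

lemma normal_PiM_hockey_stick:
  assumes I: "finite I" and \<sigma>: "\<And>i. i \<in> I \<Longrightarrow> 0 < \<sigma> i"
    and D: "D = sqrt (\<Sum>i\<in>I. ((\<mu> i - \<nu> i) / \<sigma> i)\<^sup>2)" "0 < D"
    and S: "S \<in> sets (normal_PiM I \<mu> \<sigma>)"
  shows "measure (normal_PiM I \<mu> \<sigma>) S - exp \<epsilon> * measure (normal_PiM I \<nu> \<sigma>) S \<le> gaussian_delta \<epsilon> D"
proof -
  let ?loss = "normal_privacy_loss I \<mu> \<nu> \<sigma>"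
  have fin: "finite_measure (normal_PiM I m \<sigma>)" for m
    using prob_space_normal_PiM[of I \<sigma> m] \<sigma> by (simp add: prob_space_def)
  have "measure (normal_PiM I \<mu> \<sigma>) S - exp \<epsilon> * measure (normal_PiM I \<nu> \<sigma>) S
      \<le> measure (normal_PiM I \<mu> \<sigma>) {x \<in> space (PiM I (\<lambda>_. lborel)). \<epsilon> < ?loss x}
        - exp \<epsilon> * measure (normal_PiM I \<nu> \<sigma>) {x \<in> space (PiM I (\<lambda>_. lborel)). \<epsilon> < ?loss x}"
    unfolding normal_PiM_eq_density[OF I]
    by (rule hockey_stick_le_loss_set)
      (use fin S in \<open>auto simp: normal_PiM_eq_density[OF I] prod_normal_density_eq_exp_loss[OF I \<sigma>] prod_nonneg\<close>)
  also have "\<dots> = gaussian_delta \<epsilon> D"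
    using D measure_normal_PiM_loss_greater[OF I \<sigma> D, of _ \<epsilon>]
    by (simp add: space_normal_PiM space_PiM normal_privacy_loss_at_means gaussian_delta_def
        power2_eq_square field_simps)
  finally show ?thesis .
qed

lemma gaussian_delta_mono:
  assumes D1: "0 < D1" and le: "D1 \<le> D2"
  shows "gaussian_delta \<epsilon> D1 \<le> gaussian_delta \<epsilon> D2"
proof -
  \<comment> \<open>Testing a pair of planar Gaussians at distance \<open>D2\<close> with the privacy-loss set of a pair
    at distance \<open>D1\<close> (the first coordinates agree) yields \<open>gaussian_delta \<epsilon> D1\<close> as a hockey-stick value.\<close>
  define I where "I = {0, 1 :: nat}"
  define \<sigma> where "\<sigma> = (\<lambda>_ :: nat. 1 :: real)"
  define \<mu> where "\<mu> = (\<lambda>i :: nat. if i = 0 then D1 else sqrt (D2\<^sup>2 - D1\<^sup>2))"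
  define \<mu>1 where "\<mu>1 = (\<lambda>i :: nat. if i = 0 then D1 else 0)"
  define \<nu> where "\<nu> = (\<lambda>_ :: nat. 0 :: real)"
  define S where "S = {x \<in> space (normal_PiM I \<mu> \<sigma>). \<epsilon> < normal_privacy_loss I \<mu>1 \<nu> \<sigma> x}"
  have I: "finite I" and \<sigma>: "\<And>i. i \<in> I \<Longrightarrow> 0 < \<sigma> i"
    by (simp_all add: I_def \<sigma>_def)
  have "D1\<^sup>2 \<le> D2\<^sup>2"
    using D1 le by (simp add: power_mono)
  then have D2: "D2 = sqrt (\<Sum>i\<in>I. ((\<mu> i - \<nu> i) / \<sigma> i)\<^sup>2)" "0 < D2"
    using D1 le by (simp_all add: I_def \<mu>_def \<nu>_def \<sigma>_def)
  have D1': "D1 = sqrt (\<Sum>i\<in>I. ((\<mu>1 i - \<nu> i) / \<sigma> i)\<^sup>2)"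
    using D1 by (simp add: I_def \<mu>1_def \<nu>_def \<sigma>_def)
  have "S \<in> sets (normal_PiM I \<mu> \<sigma>)"
    unfolding S_def by measurable
  from normal_PiM_hockey_stick[OF I \<sigma> D2 this]
  have "measure (normal_PiM I \<mu> \<sigma>) S - exp \<epsilon> * measure (normal_PiM I \<nu> \<sigma>) S \<le> gaussian_delta \<epsilon> D2" .
  moreover have "measure (normal_PiM I m \<sigma>) S = Phi ((normal_privacy_loss I \<mu>1 \<nu> \<sigma> m - \<epsilon>) / D1)" for m
    using measure_normal_PiM_loss_greater[OF I \<sigma> D1' D1, of m \<epsilon>] by (simp add: S_def space_normal_PiM)
  ultimately show ?thesis
    using D1 by (simp add: gaussian_delta_def normal_privacy_loss_def I_def \<mu>_def \<mu>1_def \<nu>_def \<sigma>_def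
        power2_eq_square field_simps)
qed

lemma normal_PiM_differential_privacy:
  assumes I: "finite I" and \<sigma>: "\<And>i. i \<in> I \<Longrightarrow> 0 < \<sigma> i"
    and dist: "sqrt (\<Sum>i\<in>I. ((\<mu> i - \<nu> i) / \<sigma> i)\<^sup>2) \<le> D"
    and \<epsilon>: "0 \<le> \<epsilon>" and \<delta>: "0 \<le> \<delta>" "gaussian_delta \<epsilon> D \<le> \<delta>"
    and S: "S \<in> sets (normal_PiM I \<mu> \<sigma>)"
  shows "measure (normal_PiM I \<mu> \<sigma>) S \<le> exp \<epsilon> * measure (normal_PiM I \<nu> \<sigma>) S + \<delta>"
proof (cases "(\<Sum>i\<in>I. ((\<mu> i - \<nu> i) / \<sigma> i)\<^sup>2) = 0")
  case True
  with I have disj: "\<forall>i\<in>I. \<mu> i = \<nu> i \<or> \<sigma> i = 0"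
    by (simp add: sum_nonneg_eq_0_iff)
  have "\<mu> i = \<nu> i" if "i \<in> I" for i
    using disj[rule_format, OF that] \<sigma>[OF that] by auto
  then have "normal_PiM I \<mu> \<sigma> = normal_PiM I \<nu> \<sigma>"
    by (rule normal_PiM_eqI)
  moreover have "measure (normal_PiM I \<nu> \<sigma>) S \<le> exp \<epsilon> * measure (normal_PiM I \<nu> \<sigma>) S"
    using \<epsilon> by (simp add: mult_le_cancel_right1)
  ultimately show ?thesis
    using \<delta> by simp
next
  case False
  then have pos: "0 < sqrt (\<Sum>i\<in>I. ((\<mu> i - \<nu> i) / \<sigma> i)\<^sup>2)"
    by (simp add: sum_nonneg order_neq_le_trans)
  have "measure (normal_PiM I \<mu> \<sigma>) S - exp \<epsilon> * measure (normal_PiM I \<nu> \<sigma>) S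
      \<le> gaussian_delta \<epsilon> (sqrt (\<Sum>i\<in>I. ((\<mu> i - \<nu> i) / \<sigma> i)\<^sup>2))"
    by (rule normal_PiM_hockey_stick[OF I \<sigma> refl pos S])
  also have "\<dots> \<le> gaussian_delta \<epsilon> D"
    by (rule gaussian_delta_mono[OF pos dist])
  finally show ?thesis
    using \<delta> by simp
qed

definition upper_pairs :: "nat \<Rightarrow> (nat \<times> nat) set" where
  "upper_pairs d = {(i, j). i \<le> j \<and> j < d}"

lemma finite_upper_pairs: "finite (upper_pairs d)"
  by (rule finite_subset[of _ "{..<d} \<times> {..<d}"]) (auto simp: upper_pairs_def)

lemma sum_upper_pairs_Suc:
  "(\<Sum>p\<in>upper_pairs (Suc d). f p) = (\<Sum>p\<in>upper_pairs d. f p) + (\<Sum>i\<le>d. f (i, d))"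
proof -
  have "upper_pairs (Suc d) = upper_pairs d \<union> (\<lambda>i. (i, d)) ` {..d}"
    by (auto simp: upper_pairs_def less_Suc_eq)
  moreover have "upper_pairs d \<inter> (\<lambda>i. (i, d)) ` {..d} = {}"
    by (auto simp: upper_pairs_def)
  ultimately show ?thesis
    by (simp add: sum.union_disjoint finite_upper_pairs sum.reindex inj_on_def)
qed

lemma sum_upper_pairs_t2_mult: "(\<Sum>p\<in>upper_pairs d. t2 x p * t2 x' p) = (\<Sum>i<d. x i * x' i)\<^sup>2"
proof (induction d)
  case 0
  then show ?case by (simp add: upper_pairs_def)
next
  case (Suc d)
  have cross: "t2 x (i, d) * t2 x' (i, d) = 2 * (x i * x' i) * (x d * x' d)" if "i < d" for i
    using that by (simp add: t2_def algebra_simps)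
  have "(\<Sum>i\<le>d. t2 x (i, d) * t2 x' (i, d))
      = (\<Sum>i<d. t2 x (i, d) * t2 x' (i, d)) + t2 x (d, d) * t2 x' (d, d)"
    by (simp add: lessThan_Suc_atMost[symmetric])
  also have "(\<Sum>i<d. t2 x (i, d) * t2 x' (i, d)) = (\<Sum>i<d. 2 * (x i * x' i) * (x d * x' d))"
    by (intro sum.cong refl) (simp add: cross)
  also have "t2 x (d, d) * t2 x' (d, d) = (x d * x' d)\<^sup>2"
    by (simp add: t2_def power_mult_distrib)
  finally show ?case
    by (simp add: sum_upper_pairs_Suc Suc.IH power2_sum sum_distrib_left sum_distrib_right algebra_simps)
qed

lemma out_idx_eq: "out_idx d = Inl ` {..<d} \<union> Inr ` upper_pairs d"
  by (simp add: out_idx_def upper_pairs_def)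

lemma finite_out_idx: "finite (out_idx d)"
  by (simp add: out_idx_eq finite_upper_pairs)

lemma sum_out_idx: "(\<Sum>k\<in>out_idx d. f k) = (\<Sum>i<d. f (Inl i)) + (\<Sum>p\<in>upper_pairs d. f (Inr p))"
  unfolding out_idx_eq by (subst sum.union_disjoint) (auto simp: finite_upper_pairs sum.reindex)

definition mech_sd :: "real \<Rightarrow> real \<Rightarrow> nat + nat \<times> nat \<Rightarrow> real" where
  "mech_sd \<sigma>1 \<sigma>2 k = (case k of Inl _ \<Rightarrow> \<sigma>1 | Inr _ \<Rightarrow> \<sigma>2)"

lemma mech_eq_normal_PiM: "mech d \<sigma>1 \<sigma>2 r = normal_PiM (out_idx d) (mech_mean r) (mech_sd \<sigma>1 \<sigma>2)"
  by (simp add: mech_def normal_PiM_def mech_sd_def)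

lemma mech_mean_scaled_dist:
  assumes "y\<^sup>2 = 1" and "y'\<^sup>2 = 1"
  shows "(\<Sum>k\<in>out_idx d. ((mech_mean (x, y) k - mech_mean (x', y') k) / mech_sd \<sigma>1 \<sigma>2 k)\<^sup>2)
       = ((\<Sum>i<d. (x i)\<^sup>2) + (\<Sum>i<d. (x' i)\<^sup>2) - 2 * (y * y') * (\<Sum>i<d. x i * x' i)) / \<sigma>1\<^sup>2
         + ((\<Sum>i<d. (x i)\<^sup>2)\<^sup>2 + (\<Sum>i<d. (x' i)\<^sup>2)\<^sup>2 - 2 * (\<Sum>i<d. x i * x' i)\<^sup>2) / \<sigma>2\<^sup>2"
proof -
  have "(\<Sum>i<d. (y * x i - y' * x' i)\<^sup>2)
      = (\<Sum>i<d. y\<^sup>2 * (x i)\<^sup>2 + y'\<^sup>2 * (x' i)\<^sup>2 - 2 * (y * y') * (x i * x' i))"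
    by (intro sum.cong refl) (simp add: power2_eq_square algebra_simps)
  also have "\<dots> = (\<Sum>i<d. (x i)\<^sup>2) + (\<Sum>i<d. (x' i)\<^sup>2) - 2 * (y * y') * (\<Sum>i<d. x i * x' i)"
    using assms by (simp add: sum.distrib sum_subtractf sum_distrib_left)
  finally have first: "(\<Sum>i<d. (y * x i - y' * x' i)\<^sup>2) = \<dots>" .
  have "(\<Sum>p\<in>upper_pairs d. (t2 x p - t2 x' p)\<^sup>2)
      = (\<Sum>p\<in>upper_pairs d. t2 x p * t2 x p + t2 x' p * t2 x' p - 2 * (t2 x p * t2 x' p))"
    by (intro sum.cong refl) (simp add: power2_eq_square algebra_simps)
  also have "\<dots> = (\<Sum>i<d. (x i)\<^sup>2)\<^sup>2 + (\<Sum>i<d. (x' i)\<^sup>2)\<^sup>2 - 2 * (\<Sum>i<d. x i * x' i)\<^sup>2"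
    by (simp add: sum.distrib sum_subtractf sum_distrib_left[symmetric] sum_upper_pairs_t2_mult
        power2_eq_square)
  finally have second: "(\<Sum>p\<in>upper_pairs d. (t2 x p - t2 x' p)\<^sup>2) = \<dots>" .
  have "(\<Sum>k\<in>out_idx d. ((mech_mean (x, y) k - mech_mean (x', y') k) / mech_sd \<sigma>1 \<sigma>2 k)\<^sup>2)
      = (\<Sum>i<d. (y * x i - y' * x' i)\<^sup>2) / \<sigma>1\<^sup>2 + (\<Sum>p\<in>upper_pairs d. (t2 x p - t2 x' p)\<^sup>2) / \<sigma>2\<^sup>2"
    by (simp add: sum_out_idx mech_mean_def mech_sd_def power_divide sum_divide_distrib)
  then show ?thesis
    by (simp only: first second)
qed

lemma sensitivity_polynomial_bound:
  fixes a b u c R y :: real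
  assumes c: "0 < c" and a: "0 \<le> a" "a \<le> R\<^sup>2" and b: "0 \<le> b" "b \<le> R\<^sup>2" and y: "\<bar>y\<bar> = 1"
  shows "a + b - 2 * y * u + c * (a\<^sup>2 + b\<^sup>2 - 2 * u\<^sup>2) \<le> 1 / (2 * c) + 2 * R\<^sup>2 + 2 * c * R ^ 4"
proof -
  have "a\<^sup>2 \<le> R ^ 4" "b\<^sup>2 \<le> R ^ 4"
    using a b power_mono[of a "R\<^sup>2" 2] power_mono[of b "R\<^sup>2" 2] by (simp_all add: power_mult[symmetric])
  then have "c * (a\<^sup>2 + b\<^sup>2) \<le> c * (2 * R ^ 4)"
    using c by (intro mult_left_mono) auto
  moreover have "- 2 * y * u \<le> 2 * \<bar>u\<bar>"
    using y by (auto simp: abs_if split: if_splits)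
  moreover have "2 * \<bar>u\<bar> - 2 * c * u\<^sup>2 \<le> 1 / (2 * c)"
  proof -
    have "0 \<le> (2 * c * \<bar>u\<bar> - 1)\<^sup>2 / (2 * c)"
      using c by simp
    also have "\<dots> = 2 * c * u\<^sup>2 - 2 * \<bar>u\<bar> + 1 / (2 * c)"
      using c by (simp add: field_simps power2_eq_square)
    finally show ?thesis by linarith
  qed
  ultimately show ?thesis
    using a b by (simp add: algebra_simps)
qed

lemma mech_sensitivity_bound:
  assumes \<sigma>: "0 < \<sigma>1" "0 < \<sigma>2"
    and valid: "valid_record d R (x, y)" "valid_record d R (x', y')"
  shows "\<sigma>1\<^sup>2 * (\<Sum>k\<in>out_idx d. ((mech_mean (x, y) k - mech_mean (x', y') k) / mech_sd \<sigma>1 \<sigma>2 k)\<^sup>2)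
     \<le> \<sigma>2\<^sup>2 / (2 * \<sigma>1\<^sup>2) + 2 * R\<^sup>2 + 2 * (\<sigma>1\<^sup>2 / \<sigma>2\<^sup>2) * R ^ 4"
proof -
  have norm_sq: "0 \<le> (\<Sum>i<d. (z i)\<^sup>2)" "(\<Sum>i<d. (z i)\<^sup>2) \<le> R\<^sup>2" if "valid_record d R (z, w)" for z w
  proof -
    show "0 \<le> (\<Sum>i<d. (z i)\<^sup>2)" by (simp add: sum_nonneg)
    moreover have "sqrt (\<Sum>i<d. (z i)\<^sup>2) \<le> R" using that by (simp add: valid_record_def)
    ultimately show "(\<Sum>i<d. (z i)\<^sup>2) \<le> R\<^sup>2" by (metis real_sqrt_le_iff real_sqrt_pow2 power_mono real_sqrt_ge_zero)
  qed
  define a b u where "a = (\<Sum>i<d. (x i)\<^sup>2)" and "b = (\<Sum>i<d. (x' i)\<^sup>2)" and "u = (\<Sum>i<d. x i * x' i)"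
  have y: "\<bar>y\<bar> = 1" "\<bar>y'\<bar> = 1" "\<bar>y * y'\<bar> = 1"
    using valid by (auto simp: valid_record_def)
  then have "y\<^sup>2 = 1" "y'\<^sup>2 = 1"
    by (simp_all add: power2_eq_iff_nonneg abs_if split: if_splits)
  then have "\<sigma>1\<^sup>2 * (\<Sum>k\<in>out_idx d. ((mech_mean (x, y) k - mech_mean (x', y') k) / mech_sd \<sigma>1 \<sigma>2 k)\<^sup>2)
      = \<sigma>1\<^sup>2 * ((a + b - 2 * (y * y') * u) / \<sigma>1\<^sup>2 + (a\<^sup>2 + b\<^sup>2 - 2 * u\<^sup>2) / \<sigma>2\<^sup>2)"
    by (simp add: mech_mean_scaled_dist a_def b_def u_def)
  also have "\<dots> = a + b - 2 * (y * y') * u + \<sigma>1\<^sup>2 / \<sigma>2\<^sup>2 * (a\<^sup>2 + b\<^sup>2 - 2 * u\<^sup>2)"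
    using \<sigma> by (simp add: field_simps)
  also have "\<dots> \<le> 1 / (2 * (\<sigma>1\<^sup>2 / \<sigma>2\<^sup>2)) + 2 * R\<^sup>2 + 2 * (\<sigma>1\<^sup>2 / \<sigma>2\<^sup>2) * R ^ 4"
    using \<sigma> norm_sq[OF valid(1)] norm_sq[OF valid(2)] y(3) unfolding a_def b_def
    by (intro sensitivity_polynomial_bound) auto
  finally show ?thesis
    by simp
qed

theorem lemma1:
  fixes d :: nat and R \<sigma>1 \<sigma>2 \<epsilon> \<delta> \<Delta> :: real
  assumes "d \<ge> 1" and "R > 0" and "\<sigma>1 > 0" and "\<sigma>2 > 0"
    and "\<epsilon> \<ge> 0" and "0 \<le> \<delta>" and "\<delta> \<le> 1"
    and "\<Delta> = sqrt (\<sigma>2\<^sup>2 / (2 * \<sigma>1\<^sup>2) + 2 * R\<^sup>2 + 2 * (\<sigma>1\<^sup>2 / \<sigma>2\<^sup>2) * R ^ 4)"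
    and "Phi (\<Delta> / (2 * \<sigma>1) - \<epsilon> * \<sigma>1 / \<Delta>)
           - exp \<epsilon> * Phi (- \<Delta> / (2 * \<sigma>1) - \<epsilon> * \<sigma>1 / \<Delta>) \<le> \<delta>"
  shows "is_dp (mech d \<sigma>1 \<sigma>2)
           (\<lambda>r r'. valid_record d R r \<and> valid_record d R r') \<epsilon> \<delta>"
proof -
  have \<Delta>_pos: "0 < \<Delta>"
    using assms(3,4,8) by (simp add: add_pos_nonneg)
  have sd_pos: "\<And>k. k \<in> out_idx d \<Longrightarrow> 0 < mech_sd \<sigma>1 \<sigma>2 k"
    using assms(3,4) by (simp add: mech_sd_def split: sum.split)
  have delta: "gaussian_delta \<epsilon> (\<Delta> / \<sigma>1) \<le> \<delta>"
    using assms(3,9) \<Delta>_pos by (simp add: gaussian_delta_def field_simps)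
  have dist: "sqrt (\<Sum>k\<in>out_idx d. ((mech_mean r k - mech_mean r' k) / mech_sd \<sigma>1 \<sigma>2 k)\<^sup>2) \<le> \<Delta> / \<sigma>1"
    if "valid_record d R r \<and> valid_record d R r'" for r r'
  proof -
    have "\<sigma>1\<^sup>2 * (\<Sum>k\<in>out_idx d. ((mech_mean r k - mech_mean r' k) / mech_sd \<sigma>1 \<sigma>2 k)\<^sup>2) \<le> \<Delta>\<^sup>2"
      using mech_sensitivity_bound[OF assms(3,4), of d R "fst r" "snd r" "fst r'" "snd r'"] that assms(8)
      by (simp add: add_pos_nonneg)
    from real_sqrt_le_mono[OF this] show ?thesis
      using assms(3) \<Delta>_pos by (simp add: real_sqrt_mult le_divide_eq mult.commute)
  qed
  show ?thesis
    unfolding is_dp_def mech_eq_normal_PiM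
    using normal_PiM_differential_privacy[OF finite_out_idx sd_pos dist assms(5,6) delta] by blast
qed

end
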